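(* For every integer $n\ge1$, each of $\Delta_{\mathbf d}(n)$ and $\Delta_{\overline{\mathbf d}}(n)$ is, up to sign, a product of exactly $n$ Jacobsthal numbers counted with multiplicity (where the trivial values $J_0=0$, $J_1=1$, $J_2=1$ are allowed as factors); that is, there exist nonnegative integers $a_1,\dots,a_n$ and $b_1,\dots,b_n$ with $|\Delta_{\mathbf d}(n)|=\prod_{t=1}^n J_{a_t}$ and $|\Delta_{\overline{\mathbf d}}(n)|=\prod_{t=1}^n J_{b_t}$. Moreover, if $n$ is even, then there is an integer $i>0$ with $J_i\,\Delta_{\mathbf d}(n)=-J_{i+1}\,\Delta_{\overline{\mathbf d}}(n)$.
   Context: The period-doubling sequence $\mathbf d=(d_n)_{n\ge 0}=1011101010111011\cdots$ is the fixed point starting with $1$ of the morphism $1\mapsto 10$, $0\mapsto 11$. Its complement is $\overline{\mathbf d}=(1-d_n)_{n\ge0}$. For a sequence $\mathbf s$ and $k\ge1$, $M_{\mathbf s}(k)=(s_{a+b})_{0\le a,b\le k-1}$ and $\Delta_{\mathbf s}(k)=\det M_{\mathbf s}(k)$. The Jacobsthal numbers are $J_n=(2^n-(-1)^n)/3$ for $n\ge0$. *)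

theory Defs
  imports "Jordan_Normal_Form.Determinant"
begin

(* Words over the alphabet {0, 1} are integer lists; the value of pd_letter at
   letters other than 0 and 1 is irrelevant. *)
definition pd_letter :: "int \<Rightarrow> int list" where
  "pd_letter c = (if c = 1 then [1, 0] else [1, 1])"

definition pd_morphism :: "int list \<Rightarrow> int list" where
  "pd_morphism w = concat (map pd_letter w)"

(* The n-fold iterate of the morphism on the one-letter word 1 has length 2 ^ n > n,
   and each iterate is a prefix of the next one, so this is the infinite fixed point.
   See pd_fixed_point and pd_unique below. *)
definition pd :: "nat \<Rightarrow> int" where
  "pd n = ((pd_morphism ^^ n) [1]) ! n"

definition pd_compl :: "nat \<Rightarrow> int" where
  "pd_compl n = 1 - pd n"

definition hankel_mat :: "(nat \<Rightarrow> int) \<Rightarrow> nat \<Rightarrow> int mat" where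
  "hankel_mat s k = mat k k (\<lambda>(a, b). s (a + b))"

definition hankel_det :: "(nat \<Rightarrow> int) \<Rightarrow> nat \<Rightarrow> int" where
  "hankel_det s k = det (hankel_mat s k)"

(* The division is exact: see three_jacobsthal. *)
definition jacobsthal :: "nat \<Rightarrow> int" where
  "jacobsthal n = (2 ^ n - (- 1) ^ n) div 3"

lemma three_jacobsthal: "3 * jacobsthal n = 2 ^ n - (- 1) ^ n"
proof -
  have "(3::int) dvd 2 ^ n - (- 1) ^ n"
  proof (induction n)
    case 0
    show ?case by simp
  next
    case (Suc n)
    have "(2::int) ^ Suc n - (- 1) ^ Suc n = 2 * (2 ^ n - (- 1) ^ n) + 3 * (- 1) ^ n"
      by simp
    then show ?case using Suc by (metis dvd_add dvd_mult dvd_triv_left)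
  qed
  then show ?thesis by (simp add: jacobsthal_def)
qed

lemma length_pd_letter: "length (pd_letter c) = 2"
  by (simp add: pd_letter_def)

lemma pd_morphism_Nil: "pd_morphism [] = []"
  by (simp add: pd_morphism_def)

lemma pd_morphism_append: "pd_morphism (v @ w) = pd_morphism v @ pd_morphism w"
  by (simp add: pd_morphism_def)

lemma length_pd_morphism: "length (pd_morphism w) = 2 * length w"
  by (induction w) (simp_all add: pd_morphism_def length_pd_letter)

lemma pd_morphism_take: "pd_morphism (take n w) = take (2 * n) (pd_morphism w)"
proof (cases "n \<le> length w")
  case True
  have "pd_morphism w = pd_morphism (take n w) @ pd_morphism (drop n w)"
    by (metis append_take_drop_id pd_morphism_append)
  then show ?thesis using True by (simp add: length_pd_morphism)
next
  case False
  then show ?thesis by (simp add: length_pd_morphism)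
qed

lemma length_pd_iterate: "length ((pd_morphism ^^ m) [1]) = 2 ^ m"
  by (induction m) (simp_all add: length_pd_morphism)

lemma pd_iterate_Suc: "take (2 ^ m) ((pd_morphism ^^ Suc m) [1]) = (pd_morphism ^^ m) [1]"
proof (induction m)
  case 0
  show ?case by (simp add: pd_morphism_def pd_letter_def)
next
  case (Suc m)
  have "take (2 ^ Suc m) ((pd_morphism ^^ Suc (Suc m)) [1])
      = pd_morphism (take (2 ^ m) ((pd_morphism ^^ Suc m) [1]))"
    by (simp add: pd_morphism_take)
  also have "\<dots> = (pd_morphism ^^ Suc m) [1]"
    unfolding Suc by simp
  finally show ?case .
qed

lemma pd_iterate_prefix:
  "take (2 ^ m) ((pd_morphism ^^ (m + k)) [1]) = (pd_morphism ^^ m) [1]"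
proof (induction k)
  case 0
  show ?case by (simp add: length_pd_iterate)
next
  case (Suc k)
  have "(2::nat) ^ m \<le> 2 ^ (m + k)" by simp
  then have "take (2 ^ m) ((pd_morphism ^^ (m + Suc k)) [1])
      = take (2 ^ m) (take (2 ^ (m + k)) ((pd_morphism ^^ Suc (m + k)) [1]))"
    by (simp only: take_take min_absorb1 add_Suc_right)
  also have "\<dots> = (pd_morphism ^^ m) [1]"
    unfolding pd_iterate_Suc by (rule Suc)
  finally show ?case .
qed

lemma map_pd_power: "map pd [0..<2 ^ m] = (pd_morphism ^^ m) [1]"
proof (rule nth_equalityI)
  fix i assume "i < length (map pd [0..<2 ^ m])"
  then have i: "i < 2 ^ m" by simp
  have i': "i < 2 ^ i" by (rule less_exp)
  have eq: "((pd_morphism ^^ p) [1]) ! i = ((pd_morphism ^^ q) [1]) ! i"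
    if "p \<le> q" "i < 2 ^ p" for p q
    by (metis that le_iff_add nth_take pd_iterate_prefix)
  have "pd i = ((pd_morphism ^^ m) [1]) ! i"
    unfolding pd_def by (metis eq i i' nat_le_linear)
  then show "map pd [0..<2 ^ m] ! i = ((pd_morphism ^^ m) [1]) ! i"
    using i by simp
qed (simp add: length_pd_iterate)

lemma pd_0: "pd 0 = 1"
  by (simp add: pd_def)

lemma pd_fixed_point: "pd_morphism (map pd [0..<n]) = map pd [0..<2 * n]"
proof -
  have n: "n \<le> 2 ^ n" using less_exp[of n] by simp
  have "map pd [0..<n] = take n (map pd [0..<2 ^ n])"
    using n by (simp add: take_map)
  then have "pd_morphism (map pd [0..<n]) = take (2 * n) (pd_morphism (map pd [0..<2 ^ n]))"
    by (simp only: pd_morphism_take)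
  also have "pd_morphism (map pd [0..<2 ^ n]) = map pd [0..<2 ^ Suc n]"
    by (simp only: map_pd_power funpow.simps comp_apply)
  also have "take (2 * n) (map pd [0..<2 ^ Suc n]) = map pd [0..<2 * n]"
    using n by (simp add: take_map)
  finally show ?thesis .
qed

lemma pd_unique:
  assumes "s 0 = 1" and fp: "\<And>n. pd_morphism (map s [0..<n]) = map s [0..<2 * n]"
  shows "s = pd"
proof
  fix i :: nat
  have "map s [0..<2 ^ m] = (pd_morphism ^^ m) [1]" for m
  proof (induction m)
    case 0
    show ?case using assms(1) by simp
  next
    case (Suc m)
    then show ?case using fp[of "2 ^ m"] by simp
  qed
  then have "map s [0..<2 ^ i] ! i = map pd [0..<2 ^ i] ! i"
    by (simp only: map_pd_power)
  then show "s i = pd i" using less_exp[of i] by simp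
qed

end

theory Submission
  imports Defs
begin

text \<open>Write d for the sequence, e for its complement, x(n) and y(n) for their Hankel
  determinants, D and E for their Hankel matrices of size m, and J for the all-ones matrix.
  Since d(2k) = 1, d(2k + 1) = e(k), e(2k) = 0 and e(2k + 1) = d(k), sorting the indices by parity
  turns the Hankel matrices of size 2m into blocks (J, E; E, J) and (0, D; D, 0), whence
  x(2m) = det (J + E) det (J - E) with J - E = D, and y(2m) = (-1)^m x(m)^2. As det (c J + E) is
  affine in c, det (J + E) = 2 y(m) - (-1)^m x(m). In odd size y vanishes and x(2m + 1) is, up to
  sign, the square of the determinant F(m + 1) of the matrix whose first column is 1 and whose
  other columns are those of D; up to sign, F(n) = F(c) x(h) with c and h the upper and lower
  halves of n. If J_i x(m) = - J_(i+1) y(m) for an even m, then the relation for 2m holds with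
  i + 1, by the recurrence of the Jacobsthal numbers; for odd m it holds for 2m with i = 1.\<close>

section \<open>Sorting indices by parity, and block determinants\<close>

definition interleave :: "nat \<Rightarrow> nat \<Rightarrow> nat" where
  "interleave n i = (if i < (n + 1) div 2 then 2 * i
     else if i < n then 2 * (i - (n + 1) div 2) + 1 else i)"

text \<open>An injective self-map of a finite set is a bijection; the last branch of
  \<open>interleave\<close> supplies the identity outside the set, which \<open>permutes\<close>
  demands.\<close>

lemma interleave_permutes: "interleave n permutes {0..<n}"
proof (rule inj_imp_permutes)
  show "inj_on (interleave n) {0..<n}"
    unfolding interleave_def
    by (rule inj_onI, simp split: if_splits) presburger+
qed (auto simp: interleave_def)

text \<open>Rows and columns each contribute the factor \<open>signof p\<close>, and its square is
  1.\<close>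

lemma det_permute_both:
  fixes A :: "'a :: comm_ring_1 mat"
  assumes A: "A \<in> carrier_mat n n" and p: "p permutes {0..<n}"
  shows "det (mat n n (\<lambda>(i, j). A $$ (p i, p j))) = det A"
proof -
  have lt: "p i < n" if "i < n" for i
    using permutes_in_image[OF p, of i] that by simp
  let ?B = "mat n n (\<lambda>(i, j). A $$ (p i, j))"
  let ?C = "mat n n (\<lambda>(i, j). transpose_mat ?B $$ (p i, j))"
  have "mat n n (\<lambda>(i, j). A $$ (p i, p j)) = transpose_mat ?C"
    by (rule eq_matI) (use lt in auto)
  also have "det \<dots> = det ?C"
    by (rule det_transpose[of _ n]) simp
  also have "\<dots> = signof p * det (transpose_mat ?B)"
    by (rule det_permute_rows[OF _ p]) simp
  also have "det (transpose_mat ?B) = det ?B"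
    by (rule det_transpose[of _ n]) simp
  also have "\<dots> = signof p * det A"
    by (rule det_permute_rows[OF A p])
  finally show ?thesis
    by (simp add: sign_def)
qed

lemma det_even_odd_blocks:
  fixes f :: "nat \<Rightarrow> nat \<Rightarrow> 'a :: comm_ring_1"
  assumes "n = c + h" "c = h \<or> c = Suc h"
  shows "det (mat n n (\<lambda>(i, j). f i j)) = det (four_block_mat
      (mat c c (\<lambda>(i, j). f (2 * i) (2 * j))) (mat c h (\<lambda>(i, j). f (2 * i) (2 * j + 1)))
      (mat h c (\<lambda>(i, j). f (2 * i + 1) (2 * j))) (mat h h (\<lambda>(i, j). f (2 * i + 1) (2 * j + 1))))"
    (is "det ?M = det ?F")
proof -
  have c: "(n + 1) div 2 = c" using assms by auto
  have "?F = mat n n (\<lambda>(i, j). ?M $$ (interleave n i, interleave n j))"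
  proof (rule eq_matI)
    fix i j assume ij: "i < dim_row (mat n n (\<lambda>(i, j). ?M $$ (interleave n i, interleave n j)))"
      "j < dim_col (mat n n (\<lambda>(i, j). ?M $$ (interleave n i, interleave n j)))"
    have "interleave n i < n" "interleave n j < n"
      using permutes_in_image[OF interleave_permutes, of n] ij by simp_all
    with ij show "?F $$ (i, j) = mat n n (\<lambda>(i, j). ?M $$ (interleave n i, interleave n j)) $$ (i, j)"
      using assms(1) c by (simp add: interleave_def)
  qed (use assms in auto)
  then show ?thesis
    using det_permute_both[OF _ interleave_permutes, of ?M n] by simp
qed

text \<open>Adding the second block row to the first and then subtracting the first block column
  from the second makes the matrix block triangular with diagonal blocks \<open>A + B\<close> and
  \<open>A - B\<close>; \<open>U\<close> and \<open>V\<close> perform these operations.\<close>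

lemma det_block_symmetric:
  fixes A B :: "'a :: idom mat"
  assumes A: "A \<in> carrier_mat n n" and B: "B \<in> carrier_mat n n"
  shows "det (four_block_mat A B B A) = det (A + B) * det (A - B)"
proof -
  let ?I = "1\<^sub>m n :: 'a mat" and ?Z = "0\<^sub>m n n :: 'a mat"
  let ?U = "four_block_mat ?I ?I ?Z ?I" and ?V = "four_block_mat ?I (- ?I) ?Z ?I"
  let ?M = "four_block_mat A B B A"
  have UM: "?U * ?M = four_block_mat (A + B) (A + B) B A"
    using A B by (subst mult_four_block_mat) (auto simp: comm_add_mat)
  have UMV: "?U * ?M * ?V = four_block_mat (A + B) ?Z B (A - B)"
    unfolding UM using A B
    by (subst mult_four_block_mat) (auto intro!: cong_four_block_mat eq_matI)
  have d: "det ?U = 1" "det ?V = 1"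
    by (subst det_four_block_mat_lower_left_zero; auto)+
  have carr: "?U \<in> carrier_mat (n + n) (n + n)" "?M \<in> carrier_mat (n + n) (n + n)"
    "?V \<in> carrier_mat (n + n) (n + n)"
    using A B by auto
  have "det ?M = det (?U * ?M * ?V)"
    by (simp only: det_mult[OF mult_carrier_mat[OF carr(1,2)] carr(3)]
        det_mult[OF carr(1,2)] d mult_1_left mult_1_right)
  also have "\<dots> = det (A + B) * det (A - B)"
    unfolding UMV using A B by (subst det_four_block_mat_upper_right_zero) auto
  finally show ?thesis .
qed

section \<open>Perturbation by multiples of the all-ones matrix\<close>

definition ones_mat :: "nat \<Rightarrow> int mat" where
  "ones_mat n = mat n n (\<lambda>_. 1)"

lemma ones_mat_carrier [simp]: "ones_mat n \<in> carrier_mat n n"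
  by (simp add: ones_mat_def)

lemma hankel_mat_carrier [simp]: "hankel_mat s n \<in> carrier_mat n n"
  by (simp add: hankel_mat_def)

text \<open>Adding a multiple of the all-ones matrix corresponds to changing the first row of a
  bordered matrix, in which the determinant is affine.\<close>

lemma det_add_ones_affine:
  fixes A :: "int mat"
  assumes A: "A \<in> carrier_mat n n"
  obtains a b where "\<And>c. det (c \<cdot>\<^sub>m ones_mat n + A) = a + c * b"
proof -
  define B where "B c = four_block_mat (1\<^sub>m 1) (mat 1 n (\<lambda>_. - c)) (mat n 1 (\<lambda>_. 1)) A" for c :: int
  have carr: "B c \<in> carrier_mat (1 + n) (1 + n)" for c
    unfolding B_def using A by (intro four_block_carrier_mat) auto
  define L where "L = four_block_mat (1\<^sub>m 1) (0\<^sub>m 1 n) (mat n 1 (\<lambda>_. -1)) (1\<^sub>m n :: int mat)"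
  have carrL: "L \<in> carrier_mat (1 + n) (1 + n)"
    unfolding L_def by (intro four_block_carrier_mat) auto
  have L: "det L = 1"
    unfolding L_def by (subst det_four_block_mat_upper_right_zero) auto
  \<comment> \<open>\<open>L\<close> subtracts the first row from all others: this clears the column
    of ones and adds \<open>c\<close> to every entry of \<open>A\<close>.\<close>
  have LB: "L * B c = four_block_mat (1\<^sub>m 1) (mat 1 n (\<lambda>_. - c)) (0\<^sub>m n 1) (c \<cdot>\<^sub>m ones_mat n + A)" for c
    unfolding L_def B_def using A
    by (subst mult_four_block_mat)
       (auto intro!: cong_four_block_mat eq_matI simp: ones_mat_def scalar_prod_def)
  have det_B: "det (c \<cdot>\<^sub>m ones_mat n + A) = det (B c)" for c
  proof -
    have "det (B c) = det (L * B c)"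
      using L by (simp add: det_mult[OF carrL carr])
    also have "\<dots> = det (c \<cdot>\<^sub>m ones_mat n + A)"
      unfolding LB using A by (subst det_four_block_mat_lower_left_zero) auto
    finally show ?thesis ..
  qed
  \<comment> \<open>The parameter \<open>c\<close> occurs in row 0 only, so the cofactors along that
    row are constants.\<close>
  have del: "mat_delete (B c) 0 j = mat_delete (B 0) 0 j" for c j
    unfolding mat_delete_def B_def using A by (intro eq_matI) auto
  define C where "C j = cofactor (B 0) 0 j" for j
  have cof: "cofactor (B c) 0 j = C j" for c j
    unfolding C_def cofactor_def del[of c j] ..
  have "det (B c) = C 0 + c * (\<Sum>j<n. - C (Suc j))" for c
  proof -
    have "det (B c) = (\<Sum>j<Suc n. B c $$ (0, j) * C j)"
      using laplace_expansion_row[OF carr, of 0 c] by (simp add: cof)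
    also have "\<dots> = B c $$ (0, 0) * C 0 + (\<Sum>j<n. B c $$ (0, Suc j) * C (Suc j))"
      by (rule sum.lessThan_Suc_shift)
    also have "(\<Sum>j<n. B c $$ (0, Suc j) * C (Suc j)) = (\<Sum>j<n. - c * C (Suc j))"
      by (rule sum.cong) (use A in \<open>auto simp: B_def\<close>)
    finally show ?thesis
      using A by (simp add: B_def sum_distrib_left)
  qed
  then show ?thesis
    using that det_B by simp
qed

section \<open>Bordered Hankel matrices\<close>

definition bordered_mat :: "(nat \<Rightarrow> int) \<Rightarrow> nat \<Rightarrow> int mat" where
  "bordered_mat s n = mat n n (\<lambda>(i, j). if j = 0 then 1 else s (i + j - 1))"

lemma bordered_mat_carrier [simp]: "bordered_mat s n \<in> carrier_mat n n"
  by (simp add: bordered_mat_def)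

text \<open>Complementing replaces each column except the first by the column of ones minus itself.
  The triangular matrix \<open>T\<close> performs this operation, and its diagonal entries are 1 or
  -1.\<close>

lemma abs_det_bordered_mat_complement:
  "\<bar>det (bordered_mat (\<lambda>k. 1 - s k) n)\<bar> = \<bar>det (bordered_mat s n)\<bar>"
proof -
  define T :: "int mat" where
    "T = mat n n (\<lambda>(i, j). if i = 0 then 1 else if i = j then -1 else 0)"
  have T: "T \<in> carrier_mat n n" by (simp add: T_def)
  have "bordered_mat (\<lambda>k. 1 - s k) n = bordered_mat s n * T"
  proof (rule eq_matI)
    fix i j assume "i < dim_row (bordered_mat s n * T)" "j < dim_col (bordered_mat s n * T)"
    then have ij: "i < n" "j < n" by (simp_all add: bordered_mat_def T_def)
    have "(bordered_mat s n * T) $$ (i, j) = (\<Sum>k = 0..<n. bordered_mat s n $$ (i, k) * T $$ (k, j))"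
      using ij by (simp add: bordered_mat_def T_def scalar_prod_def)
    also have "\<dots> = (\<Sum>k = 0..<n. (if k = 0 then 1 else 0) + (if k = j then if j = 0 then 0 else - s (i + j - 1) else 0))"
      by (rule sum.cong) (use ij in \<open>auto simp: bordered_mat_def T_def\<close>)
    also have "\<dots> = bordered_mat (\<lambda>k. 1 - s k) n $$ (i, j)"
      using ij by (simp add: sum.distrib bordered_mat_def)
    finally show "bordered_mat (\<lambda>k. 1 - s k) n $$ (i, j) = (bordered_mat s n * T) $$ (i, j)" ..
  qed (simp_all add: bordered_mat_def T_def)
  moreover have "\<bar>det T\<bar> = 1"
  proof -
    have "det T = prod_list (diag_mat T)"
      by (rule det_upper_triangular[OF _ T]) (auto simp: T_def)
    also have "\<bar>\<dots>\<bar> = (\<Prod>i = 0..<n. \<bar>T $$ (i, i)\<bar>)"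
      using T by (simp add: prod_list_diag_prod abs_prod)
    also have "\<dots> = 1"
      by (rule prod.neutral) (simp add: T_def)
    finally show ?thesis .
  qed
  ultimately show ?thesis
    by (simp add: det_mult[OF bordered_mat_carrier T] abs_mult)
qed

section \<open>Hankel determinants of sequences that are constant at even indices\<close>

lemma hankel_det_double:
  assumes "\<And>k. s (2 * k) = c" "\<And>k. s (2 * k + 1) = t k"
  shows "hankel_det s (2 * m) = det (c \<cdot>\<^sub>m ones_mat m + hankel_mat t m) * det (c \<cdot>\<^sub>m ones_mat m - hankel_mat t m)"
proof -
  \<comment> \<open>Indices of equal parity have an even sum and give \<open>c\<close>; mixed
    parities give \<open>t\<close>. Sorting therefore produces equal diagonal blocks and equal
    off-diagonal blocks.\<close>
  have s: "s (2 * i + 2 * j) = c" "s (2 * i + (2 * j + 1)) = t (i + j)"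
    "s (2 * i + 1 + 2 * j) = t (i + j)" "s (2 * i + 1 + (2 * j + 1)) = c" for i j
    using assms(1)[of "i + j"] assms(1)[of "i + j + 1"] assms(2)[of "i + j"]
    by (simp_all add: algebra_simps)
  have "hankel_det s (2 * m) = det (four_block_mat (c \<cdot>\<^sub>m ones_mat m) (hankel_mat t m)
      (hankel_mat t m) (c \<cdot>\<^sub>m ones_mat m))"
    unfolding hankel_det_def hankel_mat_def
    by (subst det_even_odd_blocks[where c = m and h = m], simp, simp, unfold s,
        rule arg_cong[where f = det])
       (auto intro!: cong_four_block_mat eq_matI simp: ones_mat_def)
  also have "\<dots> = det (c \<cdot>\<^sub>m ones_mat m + hankel_mat t m) * det (c \<cdot>\<^sub>m ones_mat m - hankel_mat t m)"
    by (rule det_block_symmetric[of _ m]) auto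
  finally show ?thesis .
qed

text \<open>Rules for evaluating entries of block products. Sums are split at their lower end
  because column 0 of the bordered matrix is exceptional.\<close>

lemma block_sum_simps:
  fixes z :: int and f :: "nat \<Rightarrow> int"
  shows "(if P then 1 else 0) * z = (if P then z else 0)"
    "z * (if P then x else 0) = (if P then z * x else 0)"
    "sum f {0..<Suc m} = f 0 + (\<Sum>k = 0..<m. f (Suc k))"
    "(\<Sum>k = 0..<m. if j = Suc k then f k else 0) = (if 0 < j \<and> j \<le> m then f (j - 1) else 0)"
proof -
  show "sum f {0..<Suc m} = f 0 + (\<Sum>k = 0..<m. f (Suc k))"
    by (simp add: sum.atLeast0_lessThan_Suc_shift del: sum.op_ivl_Suc)
  show "(\<Sum>k = 0..<m. if j = Suc k then f k else 0) = (if 0 < j \<and> j \<le> m then f (j - 1) else 0)"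
    by (cases j) auto
qed simp_all

text \<open>The middle factor of a factorization of odd-sized Hankel matrices (with the indices sorted by
  parity) whose outer factors are built from the bordered matrix and its transpose.\<close>

definition core_mat :: "int \<Rightarrow> nat \<Rightarrow> int mat" where
  "core_mat c m = four_block_mat
     (mat (Suc m) (Suc m) (\<lambda>(i, j). if i = 0 \<and> j = 0 then c else 0))
     (mat (Suc m) m (\<lambda>(i, j). if i = Suc j then 1 else 0))
     (mat m (Suc m) (\<lambda>(i, j). if j = Suc i then 1 else 0))
     (c \<cdot>\<^sub>m ones_mat m)"

lemma core_mat_carrier [simp]: "core_mat c m \<in> carrier_mat (Suc m + m) (Suc m + m)"
  unfolding core_mat_def by (intro four_block_carrier_mat) auto

text \<open>For \<open>c = 0\<close> the first row is zero.\<close>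

lemma det_core_mat_0: "det (core_mat 0 m) = 0"
proof -
  have "det (core_mat 0 m) = (\<Sum>j<Suc m + m. core_mat 0 m $$ (0, j) * cofactor (core_mat 0 m) 0 j)"
    by (rule laplace_expansion_row[OF core_mat_carrier]) simp
  also have "\<dots> = 0"
    by (rule sum.neutral) (auto simp: core_mat_def ones_mat_def)
  finally show ?thesis .
qed

text \<open>The integer matrix \<open>N\<close> is an explicit inverse, so the determinant is a unit
  of the integers.\<close>

lemma abs_det_core_mat_1: "\<bar>det (core_mat 1 m)\<bar> = 1"
proof -
  define N where "N = four_block_mat
     (mat (Suc m) (Suc m) (\<lambda>(i, j). if i = 0 \<and> j = 0 then 1 else if i = 0 \<or> j = 0 then 0 else -1))
     (mat (Suc m) m (\<lambda>(i, j). if i = Suc j then 1 else 0))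
     (mat m (Suc m) (\<lambda>(i, j). if j = Suc i then 1 else 0))
     (0\<^sub>m m m :: int mat)"
  have N: "N \<in> carrier_mat (Suc m + m) (Suc m + m)"
    unfolding N_def by (intro four_block_carrier_mat) auto
  have "core_mat 1 m * N = four_block_mat (1\<^sub>m (Suc m)) (0\<^sub>m (Suc m) m) (0\<^sub>m m (Suc m)) (1\<^sub>m m)"
    unfolding core_mat_def N_def
    by (subst mult_four_block_mat[of _ "Suc m" "Suc m" _ m _ m _ _ "Suc m" _ m], simp_all,
        intro cong_four_block_mat eq_matI, simp_all)
       (auto simp: scalar_prod_def ones_mat_def block_sum_simps sum_negf simp del: sum.op_ivl_Suc)
  then have "core_mat 1 m * N = 1\<^sub>m (Suc m + m)"
    by simp
  then have "det (core_mat 1 m) * det N = 1"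
    using det_mult[OF core_mat_carrier N, of 1] by simp
  then have "is_unit (det (core_mat 1 m))"
    by (metis dvd_triv_left)
  then show ?thesis
    by simp
qed

text \<open>The bordered matrix \<open>?P\<close> sends the first unit vector to the all-ones vector
  and the later ones to the columns of the Hankel block of \<open>t\<close>. Hence multiplying the
  core by \<open>Q\<close> and \<open>R\<close> turns its corner entry \<open>c\<close> into a
  constant block and its shifted identities into the \<open>t\<close> blocks. Each outer factor has
  determinant \<open>det ?P\<close>.\<close>

lemma hankel_det_double_Suc:
  assumes "\<And>k. s (2 * k) = c" "\<And>k. s (2 * k + 1) = t k"
  shows "hankel_det s (2 * m + 1) = (det (bordered_mat t (Suc m)))\<^sup>2 * det (core_mat c m)"
proof -
  have s: "s (2 * i + 2 * j) = c" "s (2 * i + (2 * j + 1)) = t (i + j)"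
    "s (2 * i + 1 + 2 * j) = t (i + j)" "s (2 * i + 1 + (2 * j + 1)) = c" for i j
    using assms(1)[of "i + j"] assms(1)[of "i + j + 1"] assms(2)[of "i + j"]
    by (simp_all add: algebra_simps)
  let ?P = "bordered_mat t (Suc m)"
  define Q where "Q = four_block_mat ?P (0\<^sub>m (Suc m) m) (0\<^sub>m m (Suc m)) (1\<^sub>m m)"
  define R where "R = four_block_mat ?P\<^sup>T (0\<^sub>m (Suc m) m) (0\<^sub>m m (Suc m)) (1\<^sub>m m)"
  have Q: "Q \<in> carrier_mat (Suc m + m) (Suc m + m)"
    unfolding Q_def by (intro four_block_carrier_mat) auto
  have R: "R \<in> carrier_mat (Suc m + m) (Suc m + m)"
    unfolding R_def by (intro four_block_carrier_mat) auto
  have det_Q: "det Q = det ?P"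
    unfolding Q_def by (subst det_four_block_mat_upper_right_zero[of _ "Suc m" _ m]) auto
  have det_R: "det R = det ?P"
    unfolding R_def
    by (subst det_four_block_mat_upper_right_zero[of _ "Suc m" _ m])
       (auto simp: det_transpose[of _ "Suc m"])
  have QK: "Q * core_mat c m = four_block_mat
      (mat (Suc m) (Suc m) (\<lambda>(i, j). if j = 0 then c else 0))
      (mat (Suc m) m (\<lambda>(i, j). t (i + j)))
      (mat m (Suc m) (\<lambda>(i, j). if j = Suc i then 1 else 0))
      (c \<cdot>\<^sub>m ones_mat m)"
    unfolding Q_def core_mat_def
    by (subst mult_four_block_mat[of _ "Suc m" "Suc m" _ m _ m _ _ "Suc m" _ m], simp_all,
        intro cong_four_block_mat eq_matI, simp_all)
       (auto simp: scalar_prod_def ones_mat_def bordered_mat_def block_sum_simps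
         simp del: sum.op_ivl_Suc)
  have QKR: "Q * core_mat c m * R = four_block_mat
      (c \<cdot>\<^sub>m ones_mat (Suc m)) (mat (Suc m) m (\<lambda>(i, j). t (i + j)))
      (mat m (Suc m) (\<lambda>(i, j). t (i + j))) (c \<cdot>\<^sub>m ones_mat m)"
    unfolding QK R_def
    by (subst mult_four_block_mat[of _ "Suc m" "Suc m" _ m _ m _ _ "Suc m" _ m], simp_all,
        intro cong_four_block_mat eq_matI, simp_all)
       (auto simp: scalar_prod_def ones_mat_def bordered_mat_def block_sum_simps
         add.commute simp del: sum.op_ivl_Suc)
  have "hankel_det s (2 * m + 1) = det (four_block_mat
      (c \<cdot>\<^sub>m ones_mat (Suc m)) (mat (Suc m) m (\<lambda>(i, j). t (i + j)))
      (mat m (Suc m) (\<lambda>(i, j). t (i + j))) (c \<cdot>\<^sub>m ones_mat m))"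
    unfolding hankel_det_def hankel_mat_def
    by (subst det_even_odd_blocks[where c = "Suc m" and h = m], simp, simp, unfold s,
        rule arg_cong[where f = det])
       (auto intro!: cong_four_block_mat simp: ones_mat_def)
  also have "\<dots> = det (Q * core_mat c m * R)"
    by (simp only: QKR)
  also have "\<dots> = det Q * det (core_mat c m) * det R"
    by (simp only: det_mult[OF mult_carrier_mat[OF Q core_mat_carrier] R] det_mult[OF Q core_mat_carrier])
  finally show ?thesis
    by (simp add: det_Q det_R power2_eq_square)
qed

text \<open>The entry in an even row and an odd column is a value of \<open>s\<close> at an even
  index, hence 0, so sorting by parity gives a block triangular matrix. The column of ones has the
  even index 0 and borders the upper left block.\<close>

lemma det_bordered_mat_even_odd:
  assumes "\<And>k. s (2 * k) = 0" "\<And>k. s (2 * k + 1) = t k"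
    and "n = c + h" "c = h \<or> c = Suc h"
  shows "det (bordered_mat s n) = det (bordered_mat t c) * det (hankel_mat t h)"
proof -
  define f where "f i j = (if j = 0 then 1 else s (i + j - 1))" for i j
  have s: "f (2 * i) (2 * j) = (if j = 0 then 1 else t (i + j - 1))"
     "f (2 * i) (2 * j + 1) = 0" "f (2 * i + 1) (2 * j + 1) = t (i + j)" for i j
    using assms(1)[of "i + j"] assms(2)[of "i + j - 1"] assms(2)[of "i + j"]
    by (auto simp: f_def algebra_simps gr0_conv_Suc)
  have "bordered_mat s n = mat n n (\<lambda>(i, j). f i j)"
    by (simp add: bordered_mat_def f_def)
  then have "det (bordered_mat s n) = det (mat n n (\<lambda>(i, j). f i j))"
    by simp
  also have "\<dots> = det (four_block_mat (bordered_mat t c) (0\<^sub>m c h)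
      (mat h c (\<lambda>(i, j). f (2 * i + 1) (2 * j))) (hankel_mat t h))"
    unfolding det_even_odd_blocks[OF assms(3,4)] s bordered_mat_def hankel_mat_def
    by (rule arg_cong[where f = det]) (auto intro!: cong_four_block_mat)
  also have "\<dots> = det (bordered_mat t c) * det (hankel_mat t h)"
    by (rule det_four_block_mat_upper_right_zero) auto
  finally show ?thesis .
qed

section \<open>Recurrences for the period-doubling sequence and its determinants\<close>

lemma pd_double_pair: "[pd (2 * k), pd (2 * k + 1)] = pd_letter (pd k)"
proof -
  \<comment> \<open>The images of the prefixes of lengths \<open>k\<close> and \<open>Suc k\<close>
    differ exactly by the image of letter \<open>k\<close>.\<close>
  have "map pd [0..<2 * k] @ pd_letter (pd k) = pd_morphism (map pd [0..<Suc k])"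
    by (simp add: pd_morphism_append pd_fixed_point) (simp add: pd_morphism_def)
  also have "\<dots> = map pd [0..<2 * Suc k]"
    by (rule pd_fixed_point)
  finally show ?thesis
    by simp
qed

lemma pd_double: "pd (2 * k) = 1"
  using pd_double_pair[of k] by (simp add: pd_letter_def split: if_splits)

lemma pd_binary: "pd k = 0 \<or> pd k = 1"
proof (cases "even k")
  case True
  then show ?thesis by (auto simp: pd_double elim!: evenE)
next
  case False
  then obtain l where "k = 2 * l + 1" by (elim oddE)
  then show ?thesis
    using pd_double_pair[of l] by (simp add: pd_letter_def split: if_splits)
qed

lemma pd_double_Suc: "pd (2 * k + 1) = pd_compl k"
  using pd_double_pair[of k] pd_binary[of k] by (auto simp: pd_letter_def pd_compl_def)

lemma pd_compl_double: "pd_compl (2 * k) = 0"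
  by (simp add: pd_compl_def pd_double)

lemma pd_compl_double_Suc: "pd_compl (2 * k + 1) = pd k"
  by (simp only: pd_compl_def pd_double_Suc diff_diff_eq2 add_diff_cancel_left')

text \<open>The affine function \<open>a + c * b\<close> is known at \<open>c = 0\<close> and at
  \<open>c = -1\<close>, where the matrix is the negative of \<open>hankel_mat pd m\<close>. Its
  value at \<open>c = 1\<close> is extrapolated as \<open>2 * a - (a - b)\<close>.\<close>

lemma hankel_det_pd_double:
  "hankel_det pd (2 * m)
    = hankel_det pd m * (2 * hankel_det pd_compl m - (- 1) ^ m * hankel_det pd m)"
proof -
  let ?E = "hankel_mat pd_compl m"
  obtain a b where ab: "\<And>c. det (c \<cdot>\<^sub>m ones_mat m + ?E) = a + c * b"
    using det_add_ones_affine hankel_mat_carrier by blast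
  have "0 \<cdot>\<^sub>m ones_mat m + ?E = ?E"
    by (rule eq_matI) (auto simp: ones_mat_def hankel_mat_def)
  then have 0: "hankel_det pd_compl m = a"
    using ab[of 0] by (simp add: hankel_det_def)
  have "(-1) \<cdot>\<^sub>m ones_mat m + ?E = (-1) \<cdot>\<^sub>m hankel_mat pd m"
    by (rule eq_matI) (auto simp: ones_mat_def hankel_mat_def pd_compl_def)
  then have 1: "(-1) ^ m * hankel_det pd m = a - b"
    using ab[of "-1"] by (simp add: hankel_det_def hankel_mat_def)
  have "hankel_det pd (2 * m) = det (1 \<cdot>\<^sub>m ones_mat m + ?E) * det (1 \<cdot>\<^sub>m ones_mat m - ?E)"
    by (rule hankel_det_double) (simp_all only: pd_double pd_double_Suc)
  also have "1 \<cdot>\<^sub>m ones_mat m - ?E = hankel_mat pd m"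
    by (rule eq_matI) (auto simp: ones_mat_def hankel_mat_def pd_compl_def)
  finally show ?thesis
    unfolding ab using 0 1 by (simp add: hankel_det_def)
qed

lemma hankel_det_pd_compl_double: "hankel_det pd_compl (2 * m) = (- 1) ^ m * (hankel_det pd m)\<^sup>2"
proof -
  let ?D = "hankel_mat pd m"
  have "hankel_det pd_compl (2 * m) = det (0 \<cdot>\<^sub>m ones_mat m + ?D) * det (0 \<cdot>\<^sub>m ones_mat m - ?D)"
    by (rule hankel_det_double) (simp_all only: pd_compl_double pd_compl_double_Suc)
  also have "0 \<cdot>\<^sub>m ones_mat m + ?D = ?D"
    by (rule eq_matI) (auto simp: ones_mat_def hankel_mat_def)
  also have "0 \<cdot>\<^sub>m ones_mat m - ?D = (-1) \<cdot>\<^sub>m ?D"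
    by (rule eq_matI) (auto simp: ones_mat_def hankel_mat_def)
  finally show ?thesis
    by (simp add: hankel_det_def hankel_mat_def power2_eq_square)
qed

lemma hankel_det_pd_compl_odd: "hankel_det pd_compl (2 * m + 1) = 0"
  by (subst hankel_det_double_Suc[where c = 0 and t = pd])
     (simp_all only: pd_compl_double pd_compl_double_Suc det_core_mat_0 mult_zero_right)

lemma abs_det_bordered_mat_pd_compl:
  "\<bar>det (bordered_mat pd_compl n)\<bar> = \<bar>det (bordered_mat pd n)\<bar>"
proof -
  have "pd_compl = (\<lambda>k. 1 - pd k)"
    by (simp add: fun_eq_iff pd_compl_def)
  then show ?thesis
    using abs_det_bordered_mat_complement[of pd n] by simp
qed

text \<open>The square absorbs the sign from replacing \<open>pd_compl\<close> by \<open>pd\<close>;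
  the absolute value absorbs the sign of the core determinant.\<close>

lemma abs_hankel_det_pd_odd: "\<bar>hankel_det pd (2 * m + 1)\<bar> = (det (bordered_mat pd (Suc m)))\<^sup>2"
proof -
  have "hankel_det pd (2 * m + 1) = (det (bordered_mat pd_compl (Suc m)))\<^sup>2 * det (core_mat 1 m)"
    by (rule hankel_det_double_Suc) (simp_all only: pd_double pd_double_Suc)
  then have "\<bar>hankel_det pd (2 * m + 1)\<bar> = \<bar>det (bordered_mat pd_compl (Suc m))\<bar>\<^sup>2"
    by (simp add: abs_mult abs_det_core_mat_1)
  then show ?thesis
    by (simp add: abs_det_bordered_mat_pd_compl)
qed

text \<open>The halving formula requires zeros at even indices, so it is applied to
  \<open>pd_compl\<close>, whose odd-indexed part is \<open>pd\<close>.\<close>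

lemma abs_det_bordered_mat_pd:
  assumes "n = c + h" "c = h \<or> c = Suc h"
  shows "\<bar>det (bordered_mat pd n)\<bar> = \<bar>det (bordered_mat pd c)\<bar> * \<bar>hankel_det pd h\<bar>"
proof -
  have "det (bordered_mat pd_compl n) = det (bordered_mat pd c) * det (hankel_mat pd h)"
    by (rule det_bordered_mat_even_odd[OF _ _ assms]) (simp_all only: pd_compl_double pd_compl_double_Suc)
  then show ?thesis
    using abs_det_bordered_mat_pd_compl[of n] by (simp add: abs_mult hankel_det_def)
qed

section \<open>Products of Jacobsthal numbers, and strong induction on the size\<close>

definition jacobsthal_product :: "nat \<Rightarrow> int \<Rightarrow> bool" where
  "jacobsthal_product k x \<longleftrightarrow> (\<exists>as. length as = k \<and> \<bar>x\<bar> = prod_list (map jacobsthal as))"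

lemma jacobsthal_product_indexed:
  assumes "jacobsthal_product k x"
  shows "\<exists>a. \<bar>x\<bar> = (\<Prod>t = 1..k. jacobsthal (a t))"
proof -
  obtain as where as: "length as = k" "\<bar>x\<bar> = prod_list (map jacobsthal as)"
    using assms by (auto simp: jacobsthal_product_def)
  have "\<bar>x\<bar> = (\<Prod>t = 0..<k. jacobsthal (as ! t))"
    using as by (simp add: prod.list_conv_set_nth)
  also have "\<dots> = (\<Prod>t = 1..k. jacobsthal (as ! (t - 1)))"
    by (rule prod.reindex_bij_witness[of _ "\<lambda>t. t - 1" Suc]) auto
  finally show ?thesis
    by (intro exI[of _ "\<lambda>t. as ! (t - 1)"])
qed

lemma jacobsthal_product_abs_cong: "\<bar>x\<bar> = \<bar>y\<bar> \<Longrightarrow> jacobsthal_product k x = jacobsthal_product k y"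
  by (simp add: jacobsthal_product_def)

lemma jacobsthal_product_mult:
  assumes "jacobsthal_product k x" "jacobsthal_product l y"
  shows "jacobsthal_product (k + l) (x * y)"
proof -
  obtain as bs where "length as = k" "\<bar>x\<bar> = prod_list (map jacobsthal as)"
    "length bs = l" "\<bar>y\<bar> = prod_list (map jacobsthal bs)"
    using assms by (auto simp: jacobsthal_product_def)
  then show ?thesis
    unfolding jacobsthal_product_def by (intro exI[of _ "as @ bs"]) (simp add: abs_mult)
qed

lemma jacobsthal_nonneg: "jacobsthal i \<ge> 0"
proof -
  have "(- 1 :: int) ^ i \<le> 2 ^ i"
    by (rule order_trans[of _ 1]) (simp_all add: minus_one_power_iff)
  then show ?thesis
    using three_jacobsthal[of i] by simp
qed

lemma jacobsthal_product_jacobsthal: "jacobsthal_product 1 (jacobsthal i)"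
  unfolding jacobsthal_product_def
  by (intro exI[of _ "[i]"]) (simp add: jacobsthal_nonneg)

lemma jacobsthal_0: "jacobsthal 0 = 0" and jacobsthal_1: "jacobsthal 1 = 1" and jacobsthal_2: "jacobsthal 2 = 1"
  by (simp_all add: jacobsthal_def)

lemma jacobsthal_rec: "jacobsthal (i + 2) = jacobsthal (i + 1) + 2 * jacobsthal i"
proof -
  have "3 * jacobsthal (i + 2) = 3 * (jacobsthal (i + 1) + 2 * jacobsthal i)"
    unfolding distrib_left mult.left_commute[of 3 2] three_jacobsthal by (simp add: field_simps)
  then show ?thesis
    by simp
qed

lemma jacobsthal_product_1: "jacobsthal_product k 1"
  unfolding jacobsthal_product_def
  by (intro exI[of _ "replicate k 1"]) (simp add: jacobsthal_1[unfolded One_nat_def])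

lemma jacobsthal_product_0: "k > 0 \<Longrightarrow> jacobsthal_product k 0"
  unfolding jacobsthal_product_def
  by (intro exI[of _ "replicate k 0"]) (simp add: jacobsthal_0)

text \<open>The count n - 1 leaves room for the extra factor in the even case: in the step to 2n the
  product P is replaced by -x(n) P, which has n + (n - 1) = 2n - 1 factors.\<close>

definition period_doubling_form :: "nat \<Rightarrow> bool" where
  "period_doubling_form n \<longleftrightarrow> jacobsthal_product (n - 1) (det (bordered_mat pd n)) \<and>
     (if odd n then jacobsthal_product (n - 1) (hankel_det pd n)
      else \<exists>i P. i > 0 \<and> jacobsthal_product (n - 1) P \<and>
        hankel_det pd n = jacobsthal (i + 1) * P \<and> hankel_det pd_compl n = - (jacobsthal i * P))"

lemma period_doubling_form_imp_product:
  assumes "period_doubling_form n" "n \<ge> 1"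
  shows "jacobsthal_product n (hankel_det pd n)"
proof -
  \<comment> \<open>The additional factor \<open>x\<close> is 1 for odd \<open>n\<close> and
    \<open>jacobsthal (i + 1)\<close> for even \<open>n\<close>.\<close>
  obtain x P where "hankel_det pd n = x * P" "jacobsthal_product 1 x" "jacobsthal_product (n - 1) P"
    using assms(1) jacobsthal_product_1[of 1] jacobsthal_product_jacobsthal
    unfolding period_doubling_form_def by (metis mult_1_left)
  then show ?thesis
    using jacobsthal_product_mult[of 1 x "n - 1" P] assms(2) by simp
qed

lemma period_doubling_form: "n \<ge> 1 \<Longrightarrow> period_doubling_form n"
proof (induction n rule: less_induct)
  case (less n)
  have B: "jacobsthal_product (n - 1) (det (bordered_mat pd n))"
  \<comment> \<open>For \<open>n = 1\<close> the upper half is again 1, so halving does not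
    descend.\<close>
  proof (cases "n = 1")
    case True
    then show ?thesis
      by (simp add: det_single bordered_mat_def jacobsthal_product_1)
  next
    case False
    define c h where "c = (n + 1) div 2" and "h = n div 2"
    have ch: "n = c + h" "c = h \<or> c = Suc h"
      unfolding c_def h_def by presburger+
    have lt: "c \<ge> 1" "h \<ge> 1" "c < n" "h < n"
      using False less.prems ch by auto
    have "jacobsthal_product (c - 1) (det (bordered_mat pd c))"
      using less.IH[OF lt(3,1)] by (simp add: period_doubling_form_def)
    moreover have "jacobsthal_product h (hankel_det pd h)"
      using less.IH[OF lt(4,2)] lt by (simp add: period_doubling_form_imp_product)
    ultimately have "jacobsthal_product (c - 1 + h) (det (bordered_mat pd c) * hankel_det pd h)"
      by (rule jacobsthal_product_mult)
    moreover have "\<bar>det (bordered_mat pd c) * hankel_det pd h\<bar> = \<bar>det (bordered_mat pd n)\<bar>"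
      by (simp add: abs_mult abs_det_bordered_mat_pd[OF ch])
    ultimately show ?thesis
      using lt ch jacobsthal_product_abs_cong by (metis Nat.add_diff_assoc2)
  qed
  show ?case
  proof (cases "odd n")
    case True
    then obtain m where m: "n = 2 * m + 1"
      by (elim oddE)
    have "jacobsthal_product m (det (bordered_mat pd (Suc m)))"
    \<comment> \<open>For \<open>m = 0\<close> the size \<open>Suc m\<close> is \<open>n\<close>
      itself, and \<open>B\<close> replaces the induction hypothesis.\<close>
    proof (cases "m = 0")
      case True
      then show ?thesis using B m by simp
    next
      case False
      then show ?thesis
        using less.IH[of "Suc m"] m by (simp add: period_doubling_form_def)
    qed
    then have "jacobsthal_product (n - 1) ((det (bordered_mat pd (Suc m)))\<^sup>2)"
      using jacobsthal_product_mult[of m _ m] m by (simp add: power2_eq_square mult_2)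
    then have "jacobsthal_product (n - 1) (hankel_det pd n)"
      using abs_hankel_det_pd_odd[of m] m
      by (subst jacobsthal_product_abs_cong[of _ "(det (bordered_mat pd (Suc m)))\<^sup>2"]) simp_all
    with B True show ?thesis
      by (simp add: period_doubling_form_def)
  next
    case False
    then obtain m where m: "n = 2 * m"
      by auto
    then have m_pos: "m \<ge> 1" "m < n"
      using less.prems by auto
    let ?x = "hankel_det pd m" and ?y = "hankel_det pd_compl m"
    have IH: "period_doubling_form m"
      using less.IH m_pos by simp
    have "\<exists>i P. i > 0 \<and> jacobsthal_product (n - 1) P \<and>
        hankel_det pd n = jacobsthal (i + 1) * P \<and> hankel_det pd_compl n = - (jacobsthal i * P)"
    proof (cases "odd m")
      case True
      then have "?y = 0"
        using hankel_det_pd_compl_odd by (elim oddE) simp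
      \<comment> \<open>Here the determinants of size \<open>n\<close> are the square of
        \<open>?x\<close> and its negative, which starts the ratios at \<open>i = 1\<close> because
        the Jacobsthal numbers of index 1 and 2 are both 1.\<close>
      then have "hankel_det pd n = jacobsthal (1 + 1) * ?x\<^sup>2"
        "hankel_det pd_compl n = - (jacobsthal 1 * ?x\<^sup>2)"
        using True m by (simp_all add: hankel_det_pd_double hankel_det_pd_compl_double
            jacobsthal_1 jacobsthal_2 one_add_one power2_eq_square del: One_nat_def)
      moreover have "jacobsthal_product (n - 1) (?x\<^sup>2)"
      proof -
        have "jacobsthal_product (m - 1) ?x"
          using IH True by (simp add: period_doubling_form_def)
        then have "jacobsthal_product (m + (m - 1)) (?x * ?x)"
          using IH m_pos by (intro jacobsthal_product_mult period_doubling_form_imp_product)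
        moreover have "m + (m - 1) = n - 1"
          using m m_pos by simp
        ultimately show ?thesis
          by (simp add: power2_eq_square)
      qed
      ultimately show ?thesis
        by (intro exI[of _ 1] exI[of _ "?x\<^sup>2"]) simp
    next
      case False
      then obtain i P where iP: "i > 0" "jacobsthal_product (m - 1) P"
        "?x = jacobsthal (i + 1) * P" "?y = - (jacobsthal i * P)"
        using IH by (auto simp: period_doubling_form_def)
      \<comment> \<open>By the recurrence, \<open>2 * ?y - ?x\<close> equals
        \<open>- (jacobsthal (i + 2) * P)\<close>; so the index grows by one and the new cofactor is
        \<open>- (?x * P)\<close>.\<close>
      have "hankel_det pd n = - (jacobsthal (i + 2) * (?x * P))"
        using False unfolding jacobsthal_rec m hankel_det_pd_double
        by (simp add: iP(3,4) algebra_simps)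
      moreover have "hankel_det pd_compl n = jacobsthal (i + 1) * (?x * P)"
        using False unfolding m hankel_det_pd_compl_double
        by (simp add: iP(3) power2_eq_square algebra_simps)
      moreover have "jacobsthal_product (n - 1) (- (?x * P))"
      proof -
        have "jacobsthal_product (m + (m - 1)) (?x * P)"
          using IH m_pos iP(2) by (intro jacobsthal_product_mult period_doubling_form_imp_product)
        moreover have "m + (m - 1) = n - 1"
          using m m_pos by simp
        ultimately show ?thesis
          by (subst jacobsthal_product_abs_cong[of _ "?x * P"]) simp_all
      qed
      ultimately show ?thesis
        by (intro exI[of _ "i + 1"] exI[of _ "- (?x * P)"]) simp
    qed
    with B False show ?thesis
      by (simp add: period_doubling_form_def)
  qed
qed

theorem theorem2:
  fixes n :: nat
  assumes "n \<ge> 1"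
  shows "(\<exists>a :: nat \<Rightarrow> nat. \<bar>hankel_det pd n\<bar> = (\<Prod>t = 1..n. jacobsthal (a t)))
    \<and> (\<exists>b :: nat \<Rightarrow> nat. \<bar>hankel_det pd_compl n\<bar> = (\<Prod>t = 1..n. jacobsthal (b t)))
    \<and> (even n \<longrightarrow> (\<exists>i :: nat. i > 0 \<and>
          jacobsthal i * hankel_det pd n = - jacobsthal (i + 1) * hankel_det pd_compl n))"
proof -
  have form: "period_doubling_form n"
    using assms by (rule period_doubling_form)
  have even: "\<exists>i P. i > 0 \<and> jacobsthal_product (n - 1) P \<and>
      hankel_det pd n = jacobsthal (i + 1) * P \<and> hankel_det pd_compl n = - (jacobsthal i * P)"
    if "even n"
    using form that by (simp add: period_doubling_form_def)
  \<comment> \<open>For even \<open>n\<close> the factor \<open>jacobsthal i\<close> joins the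
    \<open>n - 1\<close> factors of \<open>P\<close>; for odd \<open>n\<close> the determinant
    vanishes and zero factors represent it.\<close>
  have "jacobsthal_product n (hankel_det pd_compl n)"
  proof (cases "even n")
    case True
    then obtain i P where "jacobsthal_product (n - 1) P" "hankel_det pd_compl n = - (jacobsthal i * P)"
      using even by blast
    then show ?thesis
      using jacobsthal_product_mult[OF jacobsthal_product_jacobsthal, of "n - 1" P i] assms
      by (subst jacobsthal_product_abs_cong[of _ "jacobsthal i * P"]) simp_all
  next
    case False
    then have "hankel_det pd_compl n = 0"
      using hankel_det_pd_compl_odd by (elim oddE) simp
    then show ?thesis
      using assms jacobsthal_product_0 by simp
  qed
  moreover have "\<exists>i. i > 0 \<and>
      jacobsthal i * hankel_det pd n = - jacobsthal (i + 1) * hankel_det pd_compl n" if even_n: "even n"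
  proof -
    obtain i P where "i > 0" "hankel_det pd n = jacobsthal (i + 1) * P"
      "hankel_det pd_compl n = - (jacobsthal i * P)"
      using even[OF even_n] by blast
    \<comment> \<open>Both sides equal \<open>jacobsthal i * jacobsthal (i + 1) * P\<close>.\<close>
    then show ?thesis
      by (intro exI[of _ i]) simp
  qed
  ultimately show ?thesis
    using jacobsthal_product_indexed period_doubling_form_imp_product[OF form assms] by blast
qed

end
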